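(* Let $n$ be a positive integer, $m$ a nonnegative integer with $m<n$, $M\subset[n]=\{1,\dots,n\}$ a set of indices of size $m$, and let $W$ be the subspace of $\mathbb{R}^n$ defined by $x^{(M)}=0$. All $(n-m)$-dimensional affine spaces in $\mathbb{R}^n$ with common direction vector subspace $W$, which are also tangential to an ellipsoid $Q_a$ in $\mathbb{R}^n$, intersect the orthogonal complement $W^\perp$ at the points of an ellipsoid $R_a$ in $W^\perp\simeq\mathbb{R}^M$. All affine spaces in $\mathbb{R}^n$ which have nonempty intersection with the interior of $Q_a$ and are parallel to $W$ intersect $W^\perp$ at the internal points of $R_a$.
   Context: $Q$ is a symmetric positive definite $n\times n$ matrix, $v(x)={}^t\!xQx$, and, for $a\ge0$, $Q_a=\{x\in\mathbb{R}^n\mid v(x)=a\}$, with interior $\{x\mid v(x)<a\}$. Orthogonality is with respect to the standard scalar product. For $M\subset[n]$ with complement $M^c=[n]\setminus M$: $x^{(M)}=(x_j)_{j\in M}$; $W^\perp$ is identified with $\mathbb{R}^M$ via $x\mapsto x^{(M)}$; the $(n-m)$-dimensional affine spaces with direction $W$ are the sets $h(\tau)=\{x\in\mathbb{R}^n\mid x^{(M)}=\tau\}$, $\tau\in\mathbb{R}^M$. $Q^{(M)}$ is the principal submatrix of $Q$ indexed by $M$, and $Q^{(M^c\times M)}$ is the submatrix with rows in $M^c$ and columns in $M$. For $\tau\in\mathbb{R}^M$, $c_{M^c}(\tau)\in\mathbb{R}^{M^c}$ is the unique solution $y$ of $Q^{(M^c)}y=-Q^{(M^c\times M)}\tau$,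 and $\gamma_M(\tau)={}^t\tau Q^{(M)}\tau-{}^tc_{M^c}(\tau)Q^{(M^c)}c_{M^c}(\tau)$, a quadratic form in $\tau$, with $\gamma_\emptyset=0$. For $a\ge0$, $R_a=\{\tau\in\mathbb{R}^M\mid\gamma_M(\tau)=a\}$; its internal points are those $\tau$ with $\gamma_M(\tau)<a$. Conventions on the word "ellipsoid": in a one-dimensional space it consists of two (possibly coinciding) points; the singleton $\{O\}$ is also called an ellipsoid when $a=0$, as well as in the case of a zero-dimensional linear space. The tangent space of $Q_a$, $a>0$, at $x_0\in Q_a$ is the hyperplane $\{x\mid{}^t\!x_0Qx=a\}$; an affine subspace is tangential to $Q_a$ at $x_0$ if it contains $x_0$ and lies in this hyperplane. The tangent space of $Q_0=\{O\}$ at $O$ is $\mathbb{R}^n$, so any linear subspace of $\mathbb{R}^n$ is tangential to $Q_0$. *)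

theory Defs
  imports "HOL-Analysis.Analysis"
begin

section \<open>Vectors and matrices indexed by subsets of the index type\<close>

text \<open>
  For an index set \<open>I\<close>, the space \<open>\<real>\<^sup>I\<close> consists of the extensional functions on \<open>I\<close>
  (so it is a singleton if \<open>I\<close> is empty), and matrices with rows in \<open>I\<close> and columns in \<open>J\<close>
  are functions of two indices that matter only on \<open>I \<times> J\<close>.
\<close>

abbreviation vecs :: "'n set \<Rightarrow> ('n \<Rightarrow> real) set" where
  "vecs I \<equiv> I \<rightarrow>\<^sub>E UNIV"

definition subvec :: "'n set \<Rightarrow> real ^ 'n \<Rightarrow> ('n \<Rightarrow> real)" where
  "subvec I x = (\<lambda>i\<in>I. x $ i)"

definition submat :: "'n set \<Rightarrow> 'n set \<Rightarrow> real ^ 'n ^ 'n \<Rightarrow> ('n \<Rightarrow> 'n \<Rightarrow> real)" where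
  "submat I J Q = (\<lambda>i\<in>I. \<lambda>j\<in>J. Q $ i $ j)"

definition mult_vec :: "'n::finite set \<Rightarrow> 'n set \<Rightarrow> ('n \<Rightarrow> 'n \<Rightarrow> real) \<Rightarrow> ('n \<Rightarrow> real) \<Rightarrow> ('n \<Rightarrow> real)" where
  "mult_vec I J A y = (\<lambda>i\<in>I. \<Sum>j\<in>J. A i j * y j)"

definition quad_form :: "'n::finite set \<Rightarrow> ('n \<Rightarrow> 'n \<Rightarrow> real) \<Rightarrow> ('n \<Rightarrow> real) \<Rightarrow> real" where
  "quad_form I A y = (\<Sum>i\<in>I. y i * mult_vec I I A y i)"

definition sym_pos_def_on :: "'n::finite set \<Rightarrow> ('n \<Rightarrow> 'n \<Rightarrow> real) \<Rightarrow> bool" where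
  "sym_pos_def_on I A \<longleftrightarrow>
     (\<forall>i\<in>I. \<forall>j\<in>I. A i j = A j i) \<and>
     (\<forall>y\<in>vecs I. y \<noteq> (\<lambda>i\<in>I. 0) \<longrightarrow> 0 < quad_form I A y)"

text \<open>
  The ellipsoids of level \<open>a\<close> in \<open>\<real>\<^sup>I\<close>, centred at the origin. For a singleton \<open>I\<close> such a set
  consists of two points, coinciding if \<open>a = 0\<close>; for \<open>a = 0\<close> it is the origin. If \<open>I\<close> is empty,
  the only quadratic form is zero, so the set is the single point of \<open>\<real>\<^sup>I\<close> for \<open>a = 0\<close> and
  is empty for \<open>a > 0\<close>.
\<close>

definition is_ellipsoid_of_level :: "'n::finite set \<Rightarrow> real \<Rightarrow> ('n \<Rightarrow> real) set \<Rightarrow> bool" where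
  "is_ellipsoid_of_level I a E \<longleftrightarrow>
     (\<exists>P. sym_pos_def_on I P \<and> E = {y \<in> vecs I. quad_form I P y = a})"


section \<open>The ellipsoid and its tangential affine spaces\<close>

definition sym_pos_def :: "real ^ 'n ^ 'n \<Rightarrow> bool" where
  "sym_pos_def Q \<longleftrightarrow> transpose Q = Q \<and> (\<forall>x. x \<noteq> 0 \<longrightarrow> 0 < x \<bullet> (Q *v x))"

definition ellipsoid :: "real ^ 'n ^ 'n \<Rightarrow> real \<Rightarrow> (real ^ 'n) set" where
  "ellipsoid Q a = {x. x \<bullet> (Q *v x) = a}"

definition ellipsoid_interior :: "real ^ 'n ^ 'n \<Rightarrow> real \<Rightarrow> (real ^ 'n) set" where
  "ellipsoid_interior Q a = {x. x \<bullet> (Q *v x) < a}"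

definition tangent_space :: "real ^ 'n ^ 'n \<Rightarrow> real \<Rightarrow> real ^ 'n \<Rightarrow> (real ^ 'n) set" where
  "tangent_space Q a x\<^sub>0 = (if a = 0 then UNIV else {x. x\<^sub>0 \<bullet> (Q *v x) = a})"

definition tangential :: "real ^ 'n ^ 'n \<Rightarrow> real \<Rightarrow> (real ^ 'n) set \<Rightarrow> bool" where
  "tangential Q a A \<longleftrightarrow> (\<exists>x\<^sub>0\<in>ellipsoid Q a. x\<^sub>0 \<in> A \<and> A \<subseteq> tangent_space Q a x\<^sub>0)"


section \<open>The associated form in the coordinates from \<open>M\<close>\<close>

definition c_compl :: "real ^ 'n ^ 'n \<Rightarrow> 'n set \<Rightarrow> ('n \<Rightarrow> real) \<Rightarrow> ('n \<Rightarrow> real)" where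
  "c_compl Q M \<tau> =
     (THE y. y \<in> vecs (- M) \<and>
        mult_vec (- M) (- M) (submat (- M) (- M) Q) y =
        (\<lambda>i\<in>- M. - mult_vec (- M) M (submat (- M) M Q) \<tau> i))"

definition gamma :: "real ^ 'n ^ 'n \<Rightarrow> 'n set \<Rightarrow> ('n \<Rightarrow> real) \<Rightarrow> real" where
  "gamma Q M \<tau> =
     quad_form M (submat M M Q) \<tau> -
     quad_form (- M) (submat (- M) (- M) Q) (c_compl Q M \<tau>)"

definition R_ell :: "real ^ 'n ^ 'n \<Rightarrow> 'n set \<Rightarrow> real \<Rightarrow> ('n \<Rightarrow> real) set" where
  "R_ell Q M a = {\<tau> \<in> vecs M. gamma Q M \<tau> = a}"

definition R_internal :: "real ^ 'n ^ 'n \<Rightarrow> 'n set \<Rightarrow> real \<Rightarrow> ('n \<Rightarrow> real) set" where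
  "R_internal Q M a = {\<tau> \<in> vecs M. gamma Q M \<tau> < a}"

end

theory Submission
  imports Defs
begin

text \<open>
  Each affine space \<open>h(\<tau>)\<close> contains a unique point \<open>z\<close> at which the gradient of \<open>v\<close> is orthogonal
  to \<open>W\<close>. It depends linearly on \<open>\<tau>\<close>, its coordinates off \<open>M\<close> are \<open>c(\<tau>)\<close>, and
  \<open>v(z + w) = v(z) + v(w)\<close> for \<open>w \<in> W\<close>, so that \<open>\<gamma>(\<tau>) = v(z)\<close> is the minimum of \<open>v\<close> on \<open>h(\<tau>)\<close>.
  Hence \<open>h(\<tau>)\<close> meets the interior of \<open>Q\<^sub>a\<close> iff \<open>\<gamma>(\<tau>) < a\<close> and is tangential to \<open>Q\<^sub>a\<close>, necessarily
  at \<open>z\<close>, iff \<open>\<gamma>(\<tau>) = a\<close>; and \<open>\<gamma>\<close> is positive definite because \<open>\<tau> \<noteq> 0\<close> forces \<open>z \<noteq> 0\<close>.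
\<close>

definition embed :: "'n::finite set \<Rightarrow> ('n \<Rightarrow> real) \<Rightarrow> real ^ 'n" where
  "embed M \<tau> = (\<chi> i. if i \<in> M then \<tau> i else 0)"

text \<open>Prescribing x on \<open>M\<close> and requiring half the gradient,
  \<open>Q *v x\<close>, to vanish off \<open>M\<close> becomes one equation for a linear
  endomorphism of the whole space. Existence, uniqueness and linearity in \<tau> of the critical
  point then all follow from invertibility of this map.\<close>

definition mixed_coords :: "real ^ 'n ^ 'n \<Rightarrow> 'n::finite set \<Rightarrow> real ^ 'n \<Rightarrow> real ^ 'n" where
  "mixed_coords Q M x = (\<chi> i. if i \<in> M then x $ i else (Q *v x) $ i)"

definition critical_point :: "real ^ 'n ^ 'n \<Rightarrow> 'n::finite set \<Rightarrow> ('n \<Rightarrow> real) \<Rightarrow> real ^ 'n" where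
  "critical_point Q M \<tau> = inv (mixed_coords Q M) (embed M \<tau>)"

section \<open>Fibres of \<open>subvec M\<close>: translates of W and their traces on the orthogonal
  complement\<close>

lemma subvec_in_vecs [simp]: "subvec M x \<in> vecs M"
  by (simp add: subvec_def)

lemma subvec_eq_iff:
  assumes "\<tau> \<in> vecs M"
  shows "subvec M x = \<tau> \<longleftrightarrow> (\<forall>i\<in>M. x $ i = \<tau> i)"
  using assms by (auto simp: subvec_def fun_eq_iff PiE_def extensional_def restrict_def)

lemma subvec_eq_subvec_iff: "subvec M x = subvec M y \<longleftrightarrow> (\<forall>i\<in>M. x $ i = y $ i)"
  by (subst subvec_eq_iff) (auto simp: subvec_def)

lemma subvec_embed: "\<tau> \<in> vecs M \<Longrightarrow> subvec M (embed M \<tau>) = \<tau>"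
  by (simp add: subvec_eq_iff embed_def)

lemma subvec_eq_zero_iff: "subvec M x = (\<lambda>i\<in>M. 0) \<longleftrightarrow> (\<forall>i\<in>M. x $ i = 0)"
  by (subst subvec_eq_iff) auto

lemma subspace_subvec_zero: "subspace {x. subvec M x = (\<lambda>i\<in>M. 0)}"
  by (auto simp: subspace_def subvec_eq_zero_iff)

lemma dim_subvec_zero:
  fixes M :: "'n::finite set"
  shows "dim {x :: real ^ 'n. subvec M x = (\<lambda>i\<in>M. 0)} = CARD('n) - card M"
proof -
  have "{x :: real ^ 'n. subvec M x = (\<lambda>i\<in>M. 0)} = {x. \<forall>i. i \<notin> - M \<longrightarrow> x $ i = 0}"
    by (auto simp: subvec_eq_zero_iff)
  then show ?thesis
    using dim_substandard_cart[where 'a = real and d = "- M"] by (simp add: Compl_eq_Diff_UNIV card_Diff_subset dim_vec_eq)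
qed

lemma orthogonal_comp_subvec_zero:
  "{x :: real ^ 'n. subvec M x = (\<lambda>i\<in>M. 0)}\<^sup>\<bottom> = {x. \<forall>i. i \<notin> M \<longrightarrow> x $ i = 0}"
    (is "?L = ?R")
proof
  show "?L \<subseteq> ?R"
  proof
    fix x :: "real ^ 'n"
    assume x: "x \<in> ?L"
    have "x $ i = 0" if "i \<notin> M" for i
    proof -
      have "axis i 1 \<bullet> x = 0"
        using x that
        by (force simp: orthogonal_comp_def orthogonal_def subvec_eq_zero_iff axis_def)
      then show ?thesis by (simp add: inner_axis')
    qed
    then show "x \<in> ?R" by blast
  qed
  show "?R \<subseteq> ?L"
    by (auto simp: orthogonal_comp_def orthogonal_def subvec_eq_zero_iff inner_vec_def
        intro!: sum.neutral)
qed

lemma fibre_Int_orthogonal_comp: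
  assumes "\<tau> \<in> vecs M"
  shows "{x. subvec M x = \<tau>} \<inter> {x. subvec M x = (\<lambda>i\<in>M. 0)}\<^sup>\<bottom> = {embed M \<tau>}"
  unfolding orthogonal_comp_subvec_zero
  using assms by (auto simp: subvec_eq_iff embed_def vec_eq_iff)

text \<open>The translate of W by p is the fibre through p, and every \<tau> is reached by taking p
  to be \<open>embed M \<tau>\<close>.\<close>

lemma affine_parallel_subvec_zero_iff:
  fixes A :: "(real ^ 'n) set"
  shows "affine_parallel {x. subvec M x = (\<lambda>i\<in>M. 0)} A \<longleftrightarrow> (\<exists>\<tau>\<in>vecs M. A = {x. subvec M x = \<tau>})"
    (is "affine_parallel ?W A \<longleftrightarrow> _")
proof -
  have translate: "(+) p ` ?W = {x. subvec M x = subvec M p}" for p :: "real ^ 'n"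
  proof -
    have "x \<in> (+) p ` ?W" if "\<forall>i\<in>M. x $ i = p $ i" for x
      using that by (intro image_eqI[of _ _ "x - p"]) (auto simp: subvec_eq_zero_iff)
    then show ?thesis
      by (auto simp: subvec_eq_zero_iff subvec_eq_subvec_iff)
  qed
  show ?thesis
    unfolding affine_parallel_def translate
    by (metis subvec_embed subvec_in_vecs)
qed

lemma affine_fibre:
  assumes "\<tau> \<in> vecs M"
  shows "affine {x. subvec M x = \<tau>}"
  using assms
  by (simp add: affine_def subvec_eq_iff flip: distrib_right)

lemma aff_dim_fibre:
  fixes M :: "'n::finite set"
  assumes "\<tau> \<in> vecs M"
  shows "aff_dim {x :: real ^ 'n. subvec M x = \<tau>} = int (CARD('n) - card M)"
proof -
  let ?W = "{x :: real ^ 'n. subvec M x = (\<lambda>i\<in>M. 0)}"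
  have "affine_parallel ?W {x. subvec M x = \<tau>}"
    using assms affine_parallel_subvec_zero_iff by blast
  then have "aff_dim {x. subvec M x = \<tau>} = aff_dim ?W"
    by (auto simp: affine_parallel_def aff_dim_translation_eq)
  then show ?thesis
    by (simp only: aff_dim_subspace[OF subspace_subvec_zero] dim_subvec_zero)
qed

section \<open>Existence, uniqueness and minimality of the critical point\<close>

lemma sym_pos_def_inner_commute:
  assumes "sym_pos_def Q"
  shows "x \<bullet> (Q *v y) = y \<bullet> (Q *v x)"
  using assms
  by (metis dot_lmul_matrix inner_commute sym_pos_def_def transpose_matrix_vector)

lemma sym_pos_def_nonneg: "sym_pos_def Q \<Longrightarrow> 0 \<le> x \<bullet> (Q *v x)"
  by (cases "x = 0") (auto simp: sym_pos_def_def less_imp_le)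

lemma linear_mixed_coords: "linear (mixed_coords Q M)"
  by (auto simp: mixed_coords_def linear_iff vec_eq_iff matrix_vector_right_distrib
      matrix_vector_mult_scaleR)

lemma inner_disjoint_support:
  fixes x y :: "real ^ 'n"
  assumes "\<forall>i\<in>M. x $ i = 0" "\<forall>i. i \<notin> M \<longrightarrow> y $ i = 0"
  shows "x \<bullet> y = 0"
  using assms by (auto simp: inner_vec_def intro!: sum.neutral)

text \<open>A kernel vector x vanishes on \<open>M\<close> while \<open>Q *v x\<close> vanishes off
  \<open>M\<close>, so the two are orthogonal and positive definiteness gives x = 0. In finite
  dimension injectivity suffices.\<close>

lemma bij_mixed_coords:
  assumes "sym_pos_def Q"
  shows "bij (mixed_coords Q M)"
proof -
  have "x = 0" if x: "mixed_coords Q M x = 0" for x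
  proof -
    have "\<forall>i\<in>M. x $ i = 0" "\<forall>i. i \<notin> M \<longrightarrow> (Q *v x) $ i = 0"
      using x by (auto simp: mixed_coords_def vec_eq_iff split: if_splits)
    then have "x \<bullet> (Q *v x) = 0"
      by (rule inner_disjoint_support)
    then show "x = 0"
      using assms by (force simp: sym_pos_def_def)
  qed
  then have "inj (mixed_coords Q M)"
    by (simp add: linear_injective_0[OF linear_mixed_coords])
  then show ?thesis
    by (simp add: bij_def linear_injective_imp_surjective[OF linear_mixed_coords])
qed

lemma linear_inv_mixed_coords:
  assumes "sym_pos_def Q"
  shows "linear (inv (mixed_coords Q M))"
  using bij_mixed_coords[OF assms] linear_mixed_coords
  by (metis bij_betw_def linear_injective_left_inverse inv_unique_comp linear_inverse_left)

lemma critical_point_iff: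
  assumes "sym_pos_def Q" "\<tau> \<in> vecs M"
  shows "x = critical_point Q M \<tau> \<longleftrightarrow>
    subvec M x = \<tau> \<and> (\<forall>i. i \<notin> M \<longrightarrow> (Q *v x) $ i = 0)"
proof -
  have "x = critical_point Q M \<tau> \<longleftrightarrow> mixed_coords Q M x = embed M \<tau>"
    unfolding critical_point_def using bij_mixed_coords[OF assms(1), of M]
    by (metis bij_inv_eq_iff)
  then show ?thesis
    using assms(2) by (auto simp: mixed_coords_def embed_def vec_eq_iff subvec_eq_iff)
qed

lemma subvec_critical_point:
  "sym_pos_def Q \<Longrightarrow> \<tau> \<in> vecs M \<Longrightarrow> subvec M (critical_point Q M \<tau>) = \<tau>"
  using critical_point_iff by blast

lemma critical_point_gradient:
  "sym_pos_def Q \<Longrightarrow> \<tau> \<in> vecs M \<Longrightarrow> i \<notin> M \<Longrightarrow> (Q *v critical_point Q M \<tau>) $ i = 0"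
  using critical_point_iff by blast

text \<open>The difference x - z lies in W, and \<open>Q *v z\<close> is supported on
  \<open>M\<close>, hence orthogonal to W. This one identity yields both minimality and the tangency
  criterion.\<close>

lemma inner_critical_point:
  assumes "sym_pos_def Q" "\<tau> \<in> vecs M" "subvec M x = \<tau>"
  shows "critical_point Q M \<tau> \<bullet> (Q *v x) = critical_point Q M \<tau> \<bullet> (Q *v critical_point Q M \<tau>)"
proof -
  let ?z = "critical_point Q M \<tau>"
  have "(x - ?z) \<bullet> (Q *v ?z) = 0"
    using assms subvec_critical_point[OF assms(1,2)]
    by (intro inner_disjoint_support[of M])
      (auto simp: subvec_eq_iff critical_point_gradient)
  then show ?thesis
    using sym_pos_def_inner_commute[OF assms(1)] by (metis eq_iff_diff_eq_0 inner_diff_left)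
qed

lemma critical_point_minimal:
  assumes "sym_pos_def Q" "\<tau> \<in> vecs M" "subvec M x = \<tau>"
  shows "critical_point Q M \<tau> \<bullet> (Q *v critical_point Q M \<tau>) \<le> x \<bullet> (Q *v x)"
proof -
  let ?z = "critical_point Q M \<tau>"
  have "0 \<le> (x - ?z) \<bullet> (Q *v (x - ?z))"
    by (rule sym_pos_def_nonneg[OF assms(1)])
  also have "\<dots> = x \<bullet> (Q *v x) - ?z \<bullet> (Q *v ?z)"
    using inner_critical_point[OF assms] sym_pos_def_inner_commute[OF assms(1), of x ?z]
    by (simp add: matrix_vector_mult_diff_distrib inner_diff_left inner_diff_right)
  finally show ?thesis by simp
qed

section \<open>Block computation of \<open>c_compl\<close> and \<open>gamma\<close>\<close>

lemma matrix_vector_mult_split: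
  "(Q *v x) $ i = (\<Sum>j\<in>M. Q $ i $ j * x $ j) + (\<Sum>j\<in>-M. Q $ i $ j * x $ j)"
  unfolding matrix_vector_mult_def
  by (simp add: sum.union_disjoint[symmetric] Un_commute)

text \<open>The linear system defining \<open>c_compl\<close> consists of the rows of
  \<open>Q *v x = 0\<close> outside \<open>M\<close>, with the coordinates of x on \<open>M\<close>
  fixed to \<tau>. Its unique solvability is therefore inherited from the critical point.\<close>

lemma c_compl_eq:
  fixes Q :: "real ^ 'n ^ 'n"
  assumes "sym_pos_def Q" "\<tau> \<in> vecs M"
  shows "c_compl Q M \<tau> = subvec (- M) (critical_point Q M \<tau>)"
proof -
  let ?z = "critical_point Q M \<tau>"
  define P where "P = (\<lambda>y. mult_vec (- M) (- M) (submat (- M) (- M) Q) y =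
    (\<lambda>i\<in>- M. - mult_vec (- M) M (submat (- M) M Q) \<tau> i))"
  have P_iff: "P (subvec (- M) x) \<longleftrightarrow> x = ?z" if "subvec M x = \<tau>" for x
  proof -
    have \<tau>: "x $ j = \<tau> j" if "j \<in> M" for j
      using \<open>subvec M x = \<tau>\<close> assms(2) that by (simp add: subvec_eq_iff)
    have "P (subvec (- M) x) \<longleftrightarrow>
        (\<forall>i\<in>-M. (\<Sum>j\<in>-M. Q $ i $ j * x $ j) = - (\<Sum>j\<in>M. Q $ i $ j * \<tau> j))"
      by (auto simp: P_def mult_vec_def submat_def subvec_def fun_eq_iff restrict_def)
    also have "\<dots> \<longleftrightarrow> (\<forall>i. i \<notin> M \<longrightarrow> (Q *v x) $ i = 0)"
      using \<tau> by (auto simp: matrix_vector_mult_split[of Q x _ M] eq_neg_iff_add_eq_0 add.commute)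
    also have "\<dots> \<longleftrightarrow> x = ?z"
      using critical_point_iff[OF assms, of x] that by simp
    finally show ?thesis .
  qed
  have "c_compl Q M \<tau> = (THE y. y \<in> vecs (- M) \<and> P y)"
    by (simp add: c_compl_def P_def)
  also have "\<dots> = subvec (- M) ?z"
  proof (rule the_equality)
    show "subvec (- M) ?z \<in> vecs (- M) \<and> P (subvec (- M) ?z)"
      by (simp add: P_iff subvec_critical_point assms)
  next
    fix y
    assume y: "y \<in> vecs (- M) \<and> P y"
    \<comment> \<open>Gluing \<tau> and a competing solution y into a full vector makes
      \<open>P_iff\<close> applicable, which forces that vector to be the critical point.\<close>
    define x :: "real ^ 'n" where "x = (\<chi> i. if i \<in> M then \<tau> i else y i)"
    have "subvec M x = \<tau>" "subvec (- M) x = y"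
      using assms(2) y by (auto simp: subvec_eq_iff x_def)
    then show "y = subvec (- M) ?z"
      using P_iff[of x] y by simp
  qed
  finally show ?thesis .
qed

lemma quad_form_submat_subvec:
  "quad_form I (submat I I Q) (subvec I x) = (\<Sum>i\<in>I. x $ i * (\<Sum>j\<in>I. Q $ i $ j * x $ j))"
  by (simp add: quad_form_def mult_vec_def submat_def subvec_def)

text \<open>Since the gradient vanishes off \<open>M\<close>, the blocks satisfy S(-M, M) = - S(-M,
  -M), and symmetry gives S(M, -M) = S(-M, M). So the subtracted term in \<open>gamma\<close> is the
  mixed block of v(z), and the rows in \<open>M\<close> alone sum to v(z).\<close>

lemma gamma_eq:
  assumes "sym_pos_def Q" "\<tau> \<in> vecs M"
  shows "gamma Q M \<tau> = critical_point Q M \<tau> \<bullet> (Q *v critical_point Q M \<tau>)"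
proof -
  define z where "z = critical_point Q M \<tau>"
  define S where "S = (\<lambda>I J. \<Sum>i\<in>I. z $ i * (\<Sum>j\<in>J. Q $ i $ j * z $ j))"
  have split: "(\<Sum>i\<in>I. z $ i * (Q *v z) $ i) = S I M + S I (- M)" for I
    by (simp add: S_def matrix_vector_mult_split[of Q z _ M] distrib_left sum.distrib)
  have grad: "(\<Sum>i\<in>-M. z $ i * (Q *v z) $ i) = 0"
    using critical_point_gradient[OF assms] by (simp add: z_def)
  have "transpose Q = Q"
    using assms(1) by (simp add: sym_pos_def_def)
  then have sym: "Q $ i $ j = Q $ j $ i" for i j
    unfolding transpose_def by (metis vec_lambda_beta)
  have cross: "S M (- M) = S (- M) M"
    unfolding S_def sum_distrib_left
    by (subst sum.swap) (intro sum.cong refl, simp add: sym mult_ac)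
  have "gamma Q M \<tau> = S M M - S (- M) (- M)"
    unfolding gamma_def c_compl_eq[OF assms] quad_form_submat_subvec z_def[symmetric] S_def
    using quad_form_submat_subvec[of M Q z] subvec_critical_point[OF assms]
    by (simp add: z_def)
  also have "\<dots> = S M M + S M (- M)"
    using split[of "- M"] grad cross by simp
  also have "\<dots> = (\<Sum>i\<in>M. z $ i * (Q *v z) $ i) + (\<Sum>i\<in>-M. z $ i * (Q *v z) $ i)"
    using split[of M] grad by simp
  also have "\<dots> = z \<bullet> (Q *v z)"
    by (simp add: inner_vec_def sum.union_disjoint[symmetric])
  finally show ?thesis by (simp add: z_def)
qed

section \<open>Tangency, interior points and the ellipsoid of traces\<close>

lemma tangential_fibre_iff:
  assumes "sym_pos_def Q" "\<tau> \<in> vecs M"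
  shows "tangential Q a {x. subvec M x = \<tau>} \<longleftrightarrow> gamma Q M \<tau> = a"
proof
  let ?z = "critical_point Q M \<tau>"
  assume "tangential Q a {x. subvec M x = \<tau>}"
  then obtain p where p: "p \<bullet> (Q *v p) = a" "subvec M p = \<tau>"
    "\<And>x. subvec M x = \<tau> \<Longrightarrow> x \<in> tangent_space Q a p"
    by (auto simp: tangential_def ellipsoid_def)
  show "gamma Q M \<tau> = a"
  \<comment> \<open>At level 0 the tangent space is everything, so tangency only supplies a point p
    with v(p) = 0; minimality squeezes v(z) between 0 and v(p). Otherwise z itself is tested against
    the tangent hyperplane at p, and p and z pair under Q to v(z).\<close>
  proof (cases "a = 0")
    case True
    then have "?z \<bullet> (Q *v ?z) \<le> 0"
      using critical_point_minimal[OF assms p(2)] p(1) by simp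
    then show ?thesis
      using True sym_pos_def_nonneg[OF assms(1), of ?z] by (simp add: gamma_eq assms)
  next
    case False
    then have "p \<bullet> (Q *v ?z) = a"
      using p(3)[OF subvec_critical_point[OF assms]] by (simp add: tangent_space_def)
    then show ?thesis
      using inner_critical_point[OF assms p(2)] sym_pos_def_inner_commute[OF assms(1), of p ?z]
      by (simp add: gamma_eq assms)
  qed
next
  let ?z = "critical_point Q M \<tau>"
  assume a: "gamma Q M \<tau> = a"
  have "?z \<in> ellipsoid Q a" "?z \<in> {x. subvec M x = \<tau>}"
    using a by (simp_all add: ellipsoid_def gamma_eq assms subvec_critical_point)
  moreover have "{x. subvec M x = \<tau>} \<subseteq> tangent_space Q a ?z"
    using a inner_critical_point[OF assms] by (auto simp: tangent_space_def gamma_eq assms)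
  ultimately show "tangential Q a {x. subvec M x = \<tau>}"
    unfolding tangential_def by blast
qed

lemma fibre_meets_interior_iff:
  assumes "sym_pos_def Q" "\<tau> \<in> vecs M"
  shows "{x. subvec M x = \<tau>} \<inter> ellipsoid_interior Q a \<noteq> {} \<longleftrightarrow> gamma Q M \<tau> < a"
proof
  assume "{x. subvec M x = \<tau>} \<inter> ellipsoid_interior Q a \<noteq> {}"
  then show "gamma Q M \<tau> < a"
    using critical_point_minimal[OF assms]
    by (force simp: ellipsoid_interior_def gamma_eq assms)
next
  assume "gamma Q M \<tau> < a"
  then have "critical_point Q M \<tau> \<in> {x. subvec M x = \<tau>} \<inter> ellipsoid_interior Q a"
    by (simp add: ellipsoid_interior_def gamma_eq assms subvec_critical_point)
  then show "{x. subvec M x = \<tau>} \<inter> ellipsoid_interior Q a \<noteq> {}" by blast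
qed

text \<open>The matrix of \<open>gamma\<close> is the Gram matrix, for the inner product given by Q,
  of the critical points \<open>b i\<close> over the unit vectors indexed by
  \<open>M\<close>.\<close>

lemma is_ellipsoid_R_ell:
  assumes "sym_pos_def Q"
  shows "is_ellipsoid_of_level M a (R_ell Q M a)"
proof -
  define b where "b = (\<lambda>i. inv (mixed_coords Q M) (axis i 1))"
  define P where "P = (\<lambda>i j. b j \<bullet> (Q *v b i))"
  have crit: "critical_point Q M \<tau> = (\<Sum>i\<in>M. \<tau> i *\<^sub>R b i)" for \<tau>
  proof -
    have "embed M \<tau> = (\<Sum>i\<in>M. \<tau> i *\<^sub>R axis i 1)"
      by (simp add: embed_def vec_eq_iff axis_def if_distrib cong: if_cong)
    then show ?thesis
      unfolding critical_point_def b_def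
      using linear_inv_mixed_coords[OF assms, of M] by (simp add: linear_sum linear_scale)
  qed
  have quad: "quad_form M P \<tau> = gamma Q M \<tau>" if "\<tau> \<in> vecs M" for \<tau>
  proof -
    have "Q *v (\<Sum>i\<in>M. \<tau> i *\<^sub>R b i) = (\<Sum>i\<in>M. \<tau> i *\<^sub>R (Q *v b i))"
      by (simp add: linear_sum[OF matrix_vector_mul_linear] matrix_vector_mult_scaleR)
    then show ?thesis
      by (simp add: gamma_eq assms that crit quad_form_def mult_vec_def P_def inner_sum_left
          inner_sum_right mult_ac)
  qed
  have "0 < quad_form M P \<tau>" if "\<tau> \<in> vecs M" "\<tau> \<noteq> (\<lambda>i\<in>M. 0)" for \<tau>
  proof -
    have "critical_point Q M \<tau> \<noteq> 0"
      using subvec_critical_point[OF assms that(1)] that(2) by (auto simp: subvec_def)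
    then show ?thesis
      using assms by (simp add: quad gamma_eq that sym_pos_def_def)
  qed
  moreover have "P i j = P j i" for i j
    unfolding P_def by (rule sym_pos_def_inner_commute[OF assms])
  ultimately have "sym_pos_def_on M P"
    by (simp add: sym_pos_def_on_def)
  then show ?thesis
    unfolding is_ellipsoid_of_level_def R_ell_def using quad by (intro exI[of _ P]) auto
qed

theorem proposition2p4p1:
  fixes Q :: "real ^ 'n ^ 'n" and M :: "'n set" and m :: nat and a :: real
    and W :: "(real ^ 'n) set"
  assumes "sym_pos_def Q"
    and "a \<ge> 0"
    and "card M = m" and "m < CARD('n)"
    and "W = {x. subvec M x = (\<lambda>i\<in>M. 0)}"
  shows "is_ellipsoid_of_level M a (R_ell Q M a) \<and>
    (\<forall>A. affine A \<and> affine_parallel W A \<longrightarrow> (\<exists>!x. x \<in> A \<inter> W\<^sup>\<bottom>)) \<and>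
    {subvec M x | x A. affine A \<and> aff_dim A = int (CARD('n) - m) \<and> affine_parallel W A \<and>
            tangential Q a A \<and> x \<in> A \<inter> W\<^sup>\<bottom>} = R_ell Q M a \<and>
    {subvec M x | x A. affine A \<and> affine_parallel W A \<and>
            A \<inter> ellipsoid_interior Q a \<noteq> {} \<and> x \<in> A \<inter> W\<^sup>\<bottom>} = R_internal Q M a"
proof -
  have parallel: "affine_parallel W A \<longleftrightarrow> (\<exists>\<tau>\<in>vecs M. A = {x. subvec M x = \<tau>})" for A
    unfolding assms(5) by (rule affine_parallel_subvec_zero_iff)
  have meet: "{x. subvec M x = \<tau>} \<inter> W\<^sup>\<bottom> = {embed M \<tau>}" if "\<tau> \<in> vecs M" for \<tau>
    unfolding assms(5) by (rule fibre_Int_orthogonal_comp[OF that])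
  \<comment> \<open>The predicate \<open>R\<close> is left arbitrary so that tangency and meeting
    the interior are both instances: each fibre meets the complement only in
    \<open>embed M \<tau>\<close>, whose coordinates on \<open>M\<close> recover \<tau>.\<close>
  have traces: "{subvec M x | x A. affine A \<and> affine_parallel W A \<and> R A \<and> x \<in> A \<inter> W\<^sup>\<bottom>}
      = {\<tau> \<in> vecs M. R {x. subvec M x = \<tau>}}" (is "?L = ?R") for R
  proof
    show "?L \<subseteq> ?R"
    proof
      fix \<sigma>
      assume "\<sigma> \<in> ?L"
      then obtain x \<tau> where "\<sigma> = subvec M x" "\<tau> \<in> vecs M" "R {x. subvec M x = \<tau>}"
        "x \<in> {x. subvec M x = \<tau>} \<inter> W\<^sup>\<bottom>"
        unfolding parallel by blast
      then show "\<sigma> \<in> ?R" by simp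
    qed
    show "?R \<subseteq> ?L"
    proof
      fix \<tau>
      assume \<tau>: "\<tau> \<in> ?R"
      then have "\<tau> = subvec M (embed M \<tau>)" "embed M \<tau> \<in> {x. subvec M x = \<tau>} \<inter> W\<^sup>\<bottom>"
        by (simp_all only: mem_Collect_eq meet subvec_embed singletonI)
      then show "\<tau> \<in> ?L"
        using \<tau> affine_fibre[of \<tau> M] parallel by blast
    qed
  qed
  have meet_unique: "\<exists>!x. x \<in> A \<inter> W\<^sup>\<bottom>" if "affine_parallel W A" for A
    using that meet unfolding parallel by (metis singleton_iff)
  have tangents: "{subvec M x | x A. affine A \<and> aff_dim A = int (CARD('n) - m) \<and>
      affine_parallel W A \<and> tangential Q a A \<and> x \<in> A \<inter> W\<^sup>\<bottom>} = R_ell Q M a"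
  proof -
    \<comment> \<open>Regrouping puts the dimension condition into \<open>R\<close>, where
      \<open>aff_dim_fibre\<close> verifies it for every fibre.\<close>
    have "{subvec M x | x A. affine A \<and> aff_dim A = int (CARD('n) - m) \<and>
        affine_parallel W A \<and> tangential Q a A \<and> x \<in> A \<inter> W\<^sup>\<bottom>}
      = {subvec M x | x A. affine A \<and> affine_parallel W A \<and>
        (aff_dim A = int (CARD('n) - m) \<and> tangential Q a A) \<and> x \<in> A \<inter> W\<^sup>\<bottom>}"
      by (intro Collect_cong) blast
    also have "\<dots> = R_ell Q M a"
      unfolding traces using assms(3)
      by (auto simp: R_ell_def aff_dim_fibre tangential_fibre_iff[OF assms(1)])
    finally show ?thesis .
  qed
  have secants: "{subvec M x | x A. affine A \<and> affine_parallel W A \<and>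
      A \<inter> ellipsoid_interior Q a \<noteq> {} \<and> x \<in> A \<inter> W\<^sup>\<bottom>} = R_internal Q M a"
    unfolding traces R_internal_def
    by (intro Collect_cong conj_cong refl fibre_meets_interior_iff[OF assms(1)])
  show ?thesis
    by (intro conjI allI impI)
      (rule is_ellipsoid_R_ell[OF assms(1)], rule meet_unique, erule conjunct2, rule tangents,
        rule secants)
qed

end
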